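(* Let $S\in\mathbb{R}^{m\times n}$ and $x_0\in\mathbb{R}^d$. Let $(x_t)_{t\geqslant0}$ be any sequence satisfying $x_{t+1}\in x_0+H_S^{-1}\,\mathrm{span}\{\nabla f(x_0),\dots,\nabla f(x_t)\}$ for all $t\geqslant0$. Then for every $t\geqslant1$, $$\delta_t\geqslant \ell^*_t(S,x_0):=\frac12\min_{Q\in\mathbb{R}_t[X],\,Q(0)=1}\ \sum_{i=1}^d Q(\lambda_i^{-1})^2\,\xi_i^2 .$$
   Context: Let $A\in\mathbb{R}^{n\times d}$ with $n\geqslant d$, $b\in\mathbb{R}^d$, $\Lambda\in\mathbb{R}^{d\times d}$ diagonal with $\Lambda\succeq I_d$, and $\nu>0$. Set $H=A^\top A+\nu^2\Lambda$, $f(x)=\frac12 x^\top Hx-b^\top x$, $x^*=H^{-1}b$. For $S\in\mathbb{R}^{m\times n}$ set $H_S=A^\top S^\top SA+\nu^2\Lambda$ and $C_S=H^{-1/2}H_SH^{-1/2}$, with eigenvalue decomposition $C_S=\sum_{i=1}^d\lambda_iv_iv_i^\top$ ($\lambda_1\geqslant\dots\geqslant\lambda_d>0$, orthonormal $v_i$). Let $\xi_i=\langle v_i,H^{1/2}(x_0-x^* )\rangle$, $\delta_t=\frac12\|x_t-x^*\|_H^2$ with $\|z\|_H^2=z^\top Hz$, and let $\mathbb{R}_t[X]$ denote the real polynomials of degree at most $t$. *)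

theory Defs
  imports "HOL-Analysis.Analysis" "HOL-Computational_Algebra.Polynomial"
begin

text \<open>H = A^T A + nu^2 Lambda\<close>
definition hessH :: "real^'d^'n \<Rightarrow> real \<Rightarrow> real^'d^'d \<Rightarrow> real^'d^'d" where
  "hessH A \<nu> \<Lambda> = transpose A ** A + (\<nu>^2) *\<^sub>R \<Lambda>"

text \<open>H_S = A^T S^T S A + nu^2 Lambda\<close>
definition sketchH :: "real^'n^'m \<Rightarrow> real^'d^'n \<Rightarrow> real \<Rightarrow> real^'d^'d \<Rightarrow> real^'d^'d" where
  "sketchH S A \<nu> \<Lambda> = transpose A ** transpose S ** S ** A + (\<nu>^2) *\<^sub>R \<Lambda>"

text \<open>f(x) = 1/2 x^T H x - b^T x\<close>
definition fobj :: "real^'d^'d \<Rightarrow> real^'d \<Rightarrow> real^'d \<Rightarrow> real" where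
  "fobj H b x = (1/2) * (x \<bullet> (H *v x)) - b \<bullet> x"

text \<open>gradient of f (H symmetric): H x - b\<close>
definition gradf :: "real^'d^'d \<Rightarrow> real^'d \<Rightarrow> real^'d \<Rightarrow> real^'d" where
  "gradf H b x = H *v x - b"

text \<open>outer product v v^T\<close>
definition outer :: "real^'d \<Rightarrow> real^'d \<Rightarrow> real^'d^'d" where
  "outer u w = (\<chi> i j. u$i * w$j)"

text \<open>delta = 1/2 ||x - x*||_H^2\<close>
definition hnorm_sq :: "real^'d^'d \<Rightarrow> real^'d \<Rightarrow> real" where
  "hnorm_sq H z = z \<bullet> (H *v z)"

text \<open>l*_t = 1/2 min over Q of degree <= t with Q(0)=1 of sum_i Q(1/lambda_i)^2 xi_i^2
  (the minimum is attained, so it equals the infimum)\<close>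
definition lstar :: "nat \<Rightarrow> ('d::finite \<Rightarrow> real) \<Rightarrow> ('d \<Rightarrow> real) \<Rightarrow> real" where
  "lstar t lam xi = (1/2) * Inf {(\<Sum>i\<in>UNIV. (poly Q (inverse (lam i)))^2 * (xi i)^2) | Q.
       degree Q \<le> t \<and> poly Q 0 = 1}"

end

theory Submission
  imports Defs
begin

text \<open>
  Put z_k = H^(1/2) (x_k - x*). The gradient at x_k is H^(1/2) z_k, so the iteration reads
  z_(k+1) - z_0 \<in> C_S^(-1) span {z_0, ..., z_k}. By induction z_k = P_k(C_S^(-1)) z_0 for a
  polynomial P_k of degree at most k with P_k(0) = 1; in the eigenbasis of C_S this says
  <v_i, z_t> = P_t(1/lambda_i) xi_i. Hence delta_t = |z_t|^2 / 2 = sum_i P_t(1/lambda_i)^2 xi_i^2 / 2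
  is one of the values minimised in l*_t.
\<close>

lemma matrix_inv_right:
  fixes A :: "'a::semiring_1^'n^'n"
  assumes "invertible A"
  shows "A ** matrix_inv A = mat 1"
  using someI_ex[OF assms[unfolded invertible_def]] by (simp add: matrix_inv_def)

lemma matrix_inv_left:
  fixes A :: "'a::semiring_1^'n^'n"
  assumes "invertible A"
  shows "matrix_inv A ** A = mat 1"
  using someI_ex[OF assms[unfolded invertible_def]] by (simp add: matrix_inv_def)

lemma inner_transpose_mult_vector:
  fixes A :: "real^'n^'m"
  shows "z \<bullet> (transpose A *v w) = (A *v z) \<bullet> w"
  by (metis dot_lmul_matrix inner_commute transpose_matrix_vector)

lemma invertible_if_quadratic_form_pos:
  fixes M :: "real^'n^'n"
  assumes "\<And>z. z \<noteq> 0 \<Longrightarrow> z \<bullet> (M *v z) > 0"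
  shows "invertible M"
proof -
  have "M *v z = 0 \<Longrightarrow> z = 0" for z
    using assms[of z] by fastforce
  then show ?thesis
    using matrix_left_invertible_ker[of M] invertible_left_inverse[of M] by metis
qed

lemma diagonal_quadratic_form_pos:
  fixes L :: "real^'n^'n"
  assumes diag: "\<forall>i j. i \<noteq> j \<longrightarrow> L$i$j = 0" and pos: "\<forall>i. L$i$i > 0" and "z \<noteq> 0"
  shows "z \<bullet> (L *v z) > 0"
proof -
  have "(L *v z)$i = L$i$i * z$i" for i
  proof -
    have "(L *v z)$i = (\<Sum>j\<in>UNIV. L$i$j * z$j)"
      by (simp add: matrix_vector_mult_def)
    also have "\<dots> = (\<Sum>j\<in>UNIV. if j = i then L$i$i * z$i else 0)"
      using diag by (intro sum.cong) auto
    finally show ?thesis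
      by simp
  qed
  then have form: "z \<bullet> (L *v z) = (\<Sum>i\<in>UNIV. L$i$i * (z$i)\<^sup>2)"
    by (simp add: inner_vec_def power2_eq_square mult_ac)
  obtain i where "z$i \<noteq> 0"
    using \<open>z \<noteq> 0\<close> by (auto simp: vec_eq_iff)
  then show ?thesis
    unfolding form using pos by (intro sum_pos2[of UNIV i]) (auto simp: less_imp_le)
qed

lemma gram_plus_quadratic_form_pos:
  fixes B :: "real^'n^'m" and L :: "real^'n^'n"
  assumes "z \<bullet> (L *v z) > 0"
  shows "z \<bullet> ((transpose B ** B + L) *v z) > 0"
proof -
  have "z \<bullet> ((transpose B ** B + L) *v z) = (B *v z) \<bullet> (B *v z) + z \<bullet> (L *v z)"
    by (simp add: matrix_vector_mult_add_rdistrib inner_add_right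
        flip: matrix_vector_mul_assoc inner_transpose_mult_vector)
  then show ?thesis
    using assms by (simp add: add_nonneg_pos)
qed

lemma invertible_sketchH:
  fixes \<Lambda> :: "real^'d^'d"
  assumes "\<forall>i j. i \<noteq> j \<longrightarrow> \<Lambda>$i$j = 0" and "\<forall>i. \<Lambda>$i$i \<ge> 1" and "\<nu> > 0"
  shows "invertible (sketchH S A \<nu> \<Lambda>)"
proof (rule invertible_if_quadratic_form_pos)
  fix z :: "real^'d" assume "z \<noteq> 0"
  have "z \<bullet> ((\<nu>\<^sup>2 *\<^sub>R \<Lambda>) *v z) > 0"
    using assms \<open>z \<noteq> 0\<close> by (intro diagonal_quadratic_form_pos) (auto simp: less_le_trans[OF zero_less_one])
  then have "z \<bullet> ((transpose (S ** A) ** (S ** A) + \<nu>\<^sup>2 *\<^sub>R \<Lambda>) *v z) > 0"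
    by (rule gram_plus_quadratic_form_pos)
  then show "z \<bullet> (sketchH S A \<nu> \<Lambda> *v z) > 0"
    by (simp add: sketchH_def matrix_transpose_mul matrix_mul_assoc)
qed

lemma hnorm_sq_square:
  fixes R :: "real^'n^'n"
  assumes "transpose R = R"
  shows "hnorm_sq (R ** R) z = (R *v z) \<bullet> (R *v z)"
  by (metis assms hnorm_sq_def inner_transpose_mult_vector matrix_vector_mul_assoc)

lemma orthonormal_expansion:
  fixes v :: "'d::finite \<Rightarrow> real^'d"
  assumes on: "\<forall>i j. v i \<bullet> v j = (if i = j then 1 else 0)"
  shows "y = (\<Sum>k\<in>UNIV. (v k \<bullet> y) *\<^sub>R v k)" and "y \<bullet> y = (\<Sum>k\<in>UNIV. (v k \<bullet> y)\<^sup>2)"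
proof -
  define V :: "real^'d^'d" where "V = (\<chi> i. v i)"
  have "V ** transpose V = mat 1"
    using on by (simp add: V_def matrix_matrix_mult_def transpose_def mat_def vec_eq_iff inner_vec_def)
  then have VV: "transpose V ** V = mat 1"
    using matrix_left_right_inverse by blast
  have Vy: "V *v y = (\<chi> k. v k \<bullet> y)"
    by (simp add: V_def matrix_vector_mult_def vec_eq_iff inner_vec_def)
  have "y = transpose V *v (V *v y)"
    by (simp add: matrix_vector_mul_assoc VV)
  also have "\<dots> = (\<Sum>k\<in>UNIV. (v k \<bullet> y) *\<^sub>R v k)"
    unfolding Vy
    by (simp add: V_def transpose_def matrix_vector_mult_def vec_eq_iff sum_component mult.commute)
  finally show "y = (\<Sum>k\<in>UNIV. (v k \<bullet> y) *\<^sub>R v k)" .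
  have "y \<bullet> y = y \<bullet> (transpose V *v (V *v y))"
    by (simp add: matrix_vector_mul_assoc VV)
  also have "\<dots> = (\<Sum>k\<in>UNIV. (v k \<bullet> y)\<^sup>2)"
    unfolding inner_transpose_mult_vector Vy by (simp add: inner_vec_def power2_eq_square)
  finally show "y \<bullet> y = (\<Sum>k\<in>UNIV. (v k \<bullet> y)\<^sup>2)" .
qed

lemma outer_sum_mult_vector:
  fixes v :: "'i::finite \<Rightarrow> real^'d"
  shows "(\<Sum>i\<in>UNIV. lam i *\<^sub>R outer (v i) (v i)) *v w = (\<Sum>i\<in>UNIV. (lam i * (v i \<bullet> w)) *\<^sub>R v i)"
proof (rule vec_eq_iff[THEN iffD2, rule_format])
  fix a
  have "((\<Sum>i\<in>UNIV. lam i *\<^sub>R outer (v i) (v i)) *v w) $ a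
      = (\<Sum>b\<in>UNIV. \<Sum>i\<in>UNIV. lam i * v i $ a * v i $ b * w $ b)"
    by (simp add: matrix_vector_mult_def outer_def sum_distrib_right mult.assoc)
  also have "\<dots> = (\<Sum>i\<in>UNIV. \<Sum>b\<in>UNIV. lam i * v i $ a * v i $ b * w $ b)"
    by (rule sum.swap)
  also have "\<dots> = (\<Sum>i\<in>UNIV. (lam i * (v i \<bullet> w)) *\<^sub>R v i) $ a"
    by (simp add: inner_vec_def sum_distrib_left sum_distrib_right mult_ac)
  finally show "((\<Sum>i\<in>UNIV. lam i *\<^sub>R outer (v i) (v i)) *v w) $ a
      = (\<Sum>i\<in>UNIV. (lam i * (v i \<bullet> w)) *\<^sub>R v i) $ a" .
qed

lemma orthonormal_outer_sum_eigenvector: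
  fixes v :: "'i::finite \<Rightarrow> real^'d"
  assumes on: "\<forall>i j. v i \<bullet> v j = (if i = j then 1 else 0)"
  shows "(\<Sum>i\<in>UNIV. lam i *\<^sub>R outer (v i) (v i)) *v v j = lam j *\<^sub>R v j"
proof -
  have "(\<Sum>i\<in>UNIV. (lam i * (v i \<bullet> v j)) *\<^sub>R v i) = (\<Sum>i\<in>UNIV. if i = j then lam j *\<^sub>R v j else 0)"
    using on by (intro sum.cong) auto
  then show ?thesis
    by (simp add: outer_sum_mult_vector)
qed

lemma eigenvector_left_inverse:
  fixes M M' :: "real^'n^'n"
  assumes "M' ** M = mat 1" and "M *v u = c *\<^sub>R u" and "u \<noteq> 0"
  shows "M' *v u = inverse c *\<^sub>R u"
proof -
  have u: "u = c *\<^sub>R (M' *v u)"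
    by (metis assms(1,2) matrix_vector_mul_assoc matrix_vector_mul_lid matrix_vector_mult_scaleR)
  then have "c \<noteq> 0"
    using \<open>u \<noteq> 0\<close> by auto
  then show ?thesis
    by (subst u) simp
qed

lemma orthonormal_eigenbasis_coordinate:
  fixes v :: "'d::finite \<Rightarrow> real^'d" and M :: "real^'d^'d"
  assumes on: "\<forall>i j. v i \<bullet> v j = (if i = j then 1 else 0)" and eigen: "\<And>k. M *v v k = mu k *\<^sub>R v k"
  shows "v i \<bullet> (M *v y) = mu i * (v i \<bullet> y)"
proof -
  have "M *v y = (\<Sum>k\<in>UNIV. ((v k \<bullet> y) * mu k) *\<^sub>R v k)"
    by (subst orthonormal_expansion(1)[OF on, of y])
      (simp add: linear_sum[OF matrix_vector_mul_linear] matrix_vector_mult_scaleR eigen)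
  then have "v i \<bullet> (M *v y) = (\<Sum>k\<in>UNIV. ((v k \<bullet> y) * mu k) * (v i \<bullet> v k))"
    by (simp add: inner_sum_right)
  also have "\<dots> = (\<Sum>k\<in>UNIV. if k = i then (v i \<bullet> y) * mu i else 0)"
    using on by (intro sum.cong) auto
  finally show ?thesis
    by simp
qed

text \<open>
  When \<open>v\<close> is an orthonormal eigenbasis of a matrix \<open>M\<close> with eigenvalues \<open>mu\<close>, this is the
  Krylov space \<open>span {z\<^sub>0, M z\<^sub>0, \<dots>, M\<^sup>k z\<^sub>0}\<close>, described in eigencoordinates so that no
  polynomials of matrices are needed.
\<close>
definition krylov_space :: "nat \<Rightarrow> ('i \<Rightarrow> 'a::real_inner) \<Rightarrow> ('i \<Rightarrow> real) \<Rightarrow> 'a \<Rightarrow> 'a set" where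
  "krylov_space k v mu z0 = {y. \<exists>R. degree R \<le> k \<and> (\<forall>i. v i \<bullet> y = poly R (mu i) * (v i \<bullet> z0))}"

lemma subspace_krylov_space: "subspace (krylov_space k v mu z0)"
  unfolding subspace_def
proof (intro conjI ballI allI)
  show "0 \<in> krylov_space k v mu z0"
    unfolding krylov_space_def by (auto intro: exI[of _ 0])
next
  fix y w assume "y \<in> krylov_space k v mu z0" "w \<in> krylov_space k v mu z0"
  then obtain R1 R2 where "degree R1 \<le> k" "\<forall>i. v i \<bullet> y = poly R1 (mu i) * (v i \<bullet> z0)"
    and "degree R2 \<le> k" "\<forall>i. v i \<bullet> w = poly R2 (mu i) * (v i \<bullet> z0)"
    unfolding krylov_space_def by blast
  then show "y + w \<in> krylov_space k v mu z0"
    unfolding krylov_space_def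
    by (intro CollectI exI[of _ "R1 + R2"]) (simp add: degree_add_le inner_add_right distrib_right)
next
  fix c :: real and y assume "y \<in> krylov_space k v mu z0"
  then obtain R where "degree R \<le> k" "\<forall>i. v i \<bullet> y = poly R (mu i) * (v i \<bullet> z0)"
    unfolding krylov_space_def by blast
  then show "c *\<^sub>R y \<in> krylov_space k v mu z0"
    unfolding krylov_space_def by (intro CollectI exI[of _ "smult c R"]) simp
qed

lemma krylov_space_mono: "j \<le> k \<Longrightarrow> krylov_space j v mu z0 \<subseteq> krylov_space k v mu z0"
  unfolding krylov_space_def by (blast intro: order_trans)

lemma krylov_iterates_polynomial:
  fixes z :: "nat \<Rightarrow> 'a::real_inner" and M :: "'a \<Rightarrow> 'a"
  assumes coordinate: "\<And>i y. v i \<bullet> M y = mu i * (v i \<bullet> y)"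
    and iter: "\<And>k. z (Suc k) - z 0 \<in> M ` span (z ` {..k})"
  shows "\<exists>P. degree P \<le> k \<and> poly P 0 = 1 \<and> (\<forall>i. v i \<bullet> z k = poly P (mu i) * (v i \<bullet> z 0))"
proof (induction k rule: less_induct)
  case (less k)
  show ?case
  proof (cases k)
    case 0
    then show ?thesis
      by (intro exI[of _ 1]) simp
  next
    case (Suc m)
    have "z j \<in> krylov_space j v mu (z 0)" if "j \<le> m" for j
      using less[of j] that Suc unfolding krylov_space_def by auto
    then have "z j \<in> krylov_space m v mu (z 0)" if "j \<le> m" for j
      using that krylov_space_mono by blast
    then have "span (z ` {..m}) \<subseteq> krylov_space m v mu (z 0)"
      by (intro span_minimal subspace_krylov_space) auto
    moreover obtain w where "w \<in> span (z ` {..m})" and w: "z k = z 0 + M w"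
      using iter[of m] Suc by (auto simp: algebra_simps)
    ultimately obtain R where "degree R \<le> m" and R: "\<forall>i. v i \<bullet> w = poly R (mu i) * (v i \<bullet> z 0)"
      unfolding krylov_space_def by blast
    then have "degree (1 + pCons 0 R) \<le> k"
      using Suc by (intro degree_add_le) auto
    moreover have "v i \<bullet> z k = poly (1 + pCons 0 R) (mu i) * (v i \<bullet> z 0)" for i
      using R by (simp add: w inner_add_right coordinate algebra_simps)
    ultimately show ?thesis
      by (intro exI[of _ "1 + pCons 0 R"]) simp
  qed
qed

lemma conjugate_inverse_eigenvector:
  fixes R M :: "real^'n^'n"
  assumes "invertible R" and "invertible M"
    and "(matrix_inv R ** M ** matrix_inv R) *v u = c *\<^sub>R u" and "u \<noteq> 0"
  shows "(R ** matrix_inv M ** R) *v u = inverse c *\<^sub>R u"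
proof (rule eigenvector_left_inverse[OF _ assms(3,4)])
  have "(R ** matrix_inv M ** R) ** (matrix_inv R ** M ** matrix_inv R)
      = R ** (matrix_inv M ** ((R ** matrix_inv R) ** (M ** matrix_inv R)))"
    by (simp add: matrix_mul_assoc)
  also have "\<dots> = R ** ((matrix_inv M ** M) ** matrix_inv R)"
    by (simp add: matrix_inv_right[OF assms(1)] matrix_mul_assoc)
  also have "\<dots> = mat 1"
    by (simp add: matrix_inv_left[OF assms(2)] matrix_inv_right[OF assms(1)])
  finally show "(R ** matrix_inv M ** R) ** (matrix_inv R ** M ** matrix_inv R) = mat 1" .
qed

lemma preconditioned_iteration_whitened:
  fixes R M' :: "real^'d^'d"
  assumes "H *v xs = b" and "H = R ** R"
    and "x (Suc k) - x 0 \<in> (\<lambda>y. M' *v y) ` span ((\<lambda>j. gradf H b (x j)) ` {..k})"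
  shows "R *v (x (Suc k) - xs) - R *v (x 0 - xs)
    \<in> (*v) (R ** M' ** R) ` span ((\<lambda>j. R *v (x j - xs)) ` {..k})"
proof -
  obtain y where y: "y \<in> span ((\<lambda>j. gradf H b (x j)) ` {..k})"
    and step: "x (Suc k) - x 0 = M' *v y"
    using assms(3) by blast
  have "(\<lambda>j. gradf H b (x j)) ` {..k} = (*v) R ` (\<lambda>j. R *v (x j - xs)) ` {..k}"
    using assms(1,2)
    by (simp add: gradf_def image_image matrix_vector_mult_diff_distrib matrix_vector_mul_assoc)
  then obtain w where "w \<in> span ((\<lambda>j. R *v (x j - xs)) ` {..k})" and "y = R *v w"
    using y by (auto simp: linear_span_image[OF matrix_vector_mul_linear])
  moreover have "R *v (x (Suc k) - xs) - R *v (x 0 - xs) = R *v (x (Suc k) - x 0)"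
    by (simp add: matrix_vector_mult_diff_distrib)
  ultimately show ?thesis
    by (simp add: step matrix_vector_mul_assoc matrix_mul_assoc)
qed

lemma lstar_le:
  assumes "degree Q \<le> t" and "poly Q 0 = 1"
  shows "lstar t lam xi \<le> (1/2) * (\<Sum>i\<in>UNIV. (poly Q (inverse (lam i)))\<^sup>2 * (xi i)\<^sup>2)"
proof -
  have "Inf {(\<Sum>i\<in>UNIV. (poly Q (inverse (lam i)))\<^sup>2 * (xi i)\<^sup>2) | Q. degree Q \<le> t \<and> poly Q 0 = 1}
      \<le> (\<Sum>i\<in>UNIV. (poly Q (inverse (lam i)))\<^sup>2 * (xi i)\<^sup>2)"
    using assms by (intro cInf_lower bdd_belowI[of _ 0]) (auto intro: sum_nonneg)
  then show ?thesis
    unfolding lstar_def by simp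
qed

theorem lemma3p1:
  fixes A :: "real^'d^'n" and b :: "real^'d" and \<Lambda> :: "real^'d^'d" and \<nu> :: real
    and S :: "real^'n^'m" and x :: "nat \<Rightarrow> real^'d"
    and Hh :: "real^'d^'d" and lam :: "'d \<Rightarrow> real" and v :: "'d \<Rightarrow> real^'d"
  assumes nd: "CARD('d) \<le> CARD('n)"
    and Ldiag: "\<forall>i j. i \<noteq> j \<longrightarrow> \<Lambda>$i$j = 0"
    and Lge: "\<forall>i. \<Lambda>$i$i \<ge> 1"
    and nu: "\<nu> > 0"
    and Hh_sym: "transpose Hh = Hh"
    and Hh_pd: "\<forall>z. z \<noteq> 0 \<longrightarrow> z \<bullet> (Hh *v z) > 0"
    and Hh_sq: "Hh ** Hh = hessH A \<nu> \<Lambda>"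
    and v_on: "\<forall>i j. v i \<bullet> v j = (if i = j then 1 else 0)"
    and eig: "matrix_inv Hh ** sketchH S A \<nu> \<Lambda> ** matrix_inv Hh
              = (\<Sum>i\<in>UNIV. lam i *\<^sub>R outer (v i) (v i))"
    and iter: "\<forall>t. x (Suc t) - x 0 \<in>
              (\<lambda>y. matrix_inv (sketchH S A \<nu> \<Lambda>) *v y) `
                span ((\<lambda>k. gradf (hessH A \<nu> \<Lambda>) b (x k)) ` {..t})"
    and t1: "t \<ge> 1"
  shows "(1/2) * hnorm_sq (hessH A \<nu> \<Lambda>) (x t - matrix_inv (hessH A \<nu> \<Lambda>) *v b)
         \<ge> lstar t lam
              (\<lambda>i. v i \<bullet> (Hh *v (x 0 - matrix_inv (hessH A \<nu> \<Lambda>) *v b)))"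
proof -
  define H where "H = hessH A \<nu> \<Lambda>"
  define xs where "xs = matrix_inv H *v b"
  define z where "z k = Hh *v (x k - xs)" for k
  define Cinv where "Cinv = Hh ** matrix_inv (sketchH S A \<nu> \<Lambda>) ** Hh"
  have H: "H = Hh ** Hh"
    using Hh_sq H_def by simp
  have Hh_inv: "invertible Hh"
    using Hh_pd by (intro invertible_if_quadratic_form_pos) blast
  have "H *v xs = b"
    using Hh_inv by (simp add: xs_def H invertible_mult matrix_vector_mul_assoc matrix_inv_right)
  then have iter_z: "z (Suc k) - z 0 \<in> (*v) Cinv ` span (z ` {..k})" for k
    unfolding z_def Cinv_def using iter H H_def by (intro preconditioned_iteration_whitened) auto
  have "Cinv *v v j = inverse (lam j) *\<^sub>R v j" for j
    unfolding Cinv_def using Hh_inv invertible_sketchH[OF Ldiag Lge nu] v_on[rule_format, of j j]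
    by (intro conjugate_inverse_eigenvector) (auto simp: eig orthonormal_outer_sum_eigenvector[OF v_on])
  then have coordinate: "v i \<bullet> (Cinv *v y) = inverse (lam i) * (v i \<bullet> y)" for i y
    by (rule orthonormal_eigenbasis_coordinate[OF v_on])
  obtain P where "degree P \<le> t" "poly P 0 = 1"
    and coords: "\<forall>i. v i \<bullet> z t = poly P (inverse (lam i)) * (v i \<bullet> z 0)"
    using krylov_iterates_polynomial[where v = v and mu = "\<lambda>i. inverse (lam i)", OF coordinate iter_z]
    by blast
  have "hnorm_sq H (x t - xs) = (\<Sum>i\<in>UNIV. (v i \<bullet> z t)\<^sup>2)"
    unfolding H hnorm_sq_square[OF Hh_sym] z_def by (rule orthonormal_expansion(2)[OF v_on])
  also have "\<dots> = (\<Sum>i\<in>UNIV. (poly P (inverse (lam i)))\<^sup>2 * (v i \<bullet> z 0)\<^sup>2)"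
    using coords by (simp add: power_mult_distrib)
  finally show ?thesis
    using lstar_le[OF \<open>degree P \<le> t\<close> \<open>poly P 0 = 1\<close>] by (simp add: z_def xs_def H_def)
qed

end
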